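(* Let $\mathbf F$ be an analytic vector field near $0\in\mathbb R^n$, defined on an open region $\mathcal D\ni 0$, with $\mathbf F(0)=0$, such that $A=D\mathbf F|_0$ is diagonalizable with eigenvalues $\lambda_1,\dots,\lambda_n$ that are nonresonant and either all lie in the open left half-plane, or all lie in the open right half-plane, or satisfy the Siegel condition. Let $\mathcal B(0)$ be the basin of attraction of $0$ for $\dot{\mathbf x}=\mathbf F(\mathbf x)$, let $\mathbf s=(s_1,\dots,s_n)$ be the local analytic Koopman eigenfunctions near $0$ and let $\tilde s_1,\dots,\tilde s_n$ be their extensions to $\mathcal B(0)$ by the flow (see context). Let $\mathbf f$ be a vector-valued analytic observable, and assume that the Taylor expansion of $\mathbf f\circ\mathbf s^{-1}$ around the origin, with coefficients $\overline{\mathbf v}_{k_1\cdots k_n}$, is valid in all of $\mathcal B(0)$, i.e. evaluated at $\mathbf y=(\tilde s_1(\mathbf x),\dots,\tilde s_n(\mathbf x))$ it converges to $\mathbf f(\mathbf x)$ for every $\mathbf x\in\mathcal B(0)$. Then for $\mathbf x\in\mathcal B(0)$ and $t\ge 0$, $$U^t\mathbf f(\mathbf x)=\sum_{(k_1,\dots,k_n)\in\mathbb N^n}\tilde s_1^{k_1}(\mathbf x)\cdots\tilde s_n^{k_n}(\mathbf x)\,\overline{\mathbf v}_{k_1\cdots k_n}\,e^{(k_1\lambda_1+\cdots+k_n\lambda_n)t},$$ where $\tilde s_j$ are eigenfunctions of $U^t$ at $\lambda_j$ (subdomain eigenfunctions if $\mathcal B(0)$ is not the whole state space).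
   Context: $S^t$ is the flow and $U^t\mathbf f=\mathbf f\circ S^t$ is the Koopman operator; global existence and uniqueness of solutions is assumed. $\mathbb N$ includes $0$. The basin of attraction is $\mathcal B(0)=\{\mathbf x: S^t(\mathbf x)\in\mathcal D\ \forall t\ge0,\ \lim_{t\to\infty}S^t(\mathbf x)=0\}$. Nonresonant: there are no nonnegative integers $m_1,\dots,m_n$ with $\sum_k m_k\ge2$ and index $r$ with $\lambda_r=\sum_k m_k\lambda_k$. Siegel condition: there are $C>0$, $\nu>1$ with $|\lambda_r-\sum_k m_k\lambda_k|\ge C/(\sum_k m_k)^\nu$ for all $r$ and all nonnegative integers $m_k$ with $\sum_k m_k\ge 2$. Under these hypotheses the Poincar\'e(-Siegel) linearization theorem gives an analytic diffeomorphism $\mathbf y=\mathbf h(\mathbf x)$, $\mathbf h(0)=0$, on a neighborhood $N(0)$ of $0$, conjugating the system to $\dot{\mathbf y}=A\mathbf y$. With $\phi_j(\mathbf y)=\langle\mathbf y,\mathbf w_j\rangle$, where $\mathbf w_j$ are eigenvectors of $A^*$ dual to the eigenvectors of $A$, set $s_j=\phi_j\circ\mathbf h$ on $N(0)$; $\mathbf s=(s_1,\dots,s_n)$ is an analytic change of coordinates near $0$. The extension is $\tilde s_j(\mathbf z)=e^{-\lambda_jt}s_j(S^t\mathbf z)$ for any $t\ge0$ such that $S^{\tau}\mathbf z\in N(0)$ for all $\tau\ge t$. A function $\phi$ on an invariant set $E$ is an eigenfunction of $U^t$ at $\lambda$ if $\phi(S^t\mathbf x)=e^{\lambda t}\phi(\mathbf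 x)$; it is called a subdomain eigenfunction if $E$ is a proper subset of the state space. *)

theory Defs
  imports "HOL-Analysis.Analysis"
begin

definition monomial :: "'a::comm_semiring_1 ^ 'n \<Rightarrow> nat ^ 'n \<Rightarrow> 'a" where
  "monomial y k = (\<Prod>j\<in>UNIV. (y $ j) ^ (k $ j))"

text \<open>Real analyticity in several variables. Multi-index series are summed unconditionally
  (\<open>has_sum\<close>), which in finite dimension is absolute convergence.\<close>

definition real_analytic_at :: "(real ^ 'n \<Rightarrow> 'b::real_normed_vector) \<Rightarrow> real ^ 'n \<Rightarrow> bool" where
  "real_analytic_at f a \<longleftrightarrow>
     (\<exists>c r. r > 0 \<and> (\<forall>x\<in>ball a r. ((\<lambda>k. monomial (x - a) k *\<^sub>R c k) has_sum f x) UNIV))"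

definition real_analytic_on :: "(real ^ 'n \<Rightarrow> 'b::real_normed_vector) \<Rightarrow> (real ^ 'n) set \<Rightarrow> bool" where
  "real_analytic_on f U \<longleftrightarrow> (\<forall>a\<in>U. real_analytic_at f a)"

definition analytic_diffeo_on :: "(real ^ 'n \<Rightarrow> real ^ 'n) \<Rightarrow> (real ^ 'n) set \<Rightarrow> bool" where
  "analytic_diffeo_on h U \<longleftrightarrow>
     open U \<and> real_analytic_on h U \<and> inj_on h U \<and>
     open (h ` U) \<and> real_analytic_on (inv_into U h) (h ` U)"

text \<open>The vector field \<open>F\<close> lives on a state space \<open>M\<close>. Only forward time is used, so a flow defined
  for all real times is covered as well; uniqueness among global forward solutions gives uniqueness
  among solutions on \<open>[0, T]\<close>, since the latter are continued by the flow.\<close>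

definition forward_solution ::
    "(real ^ 'n \<Rightarrow> real ^ 'n) \<Rightarrow> (real ^ 'n) set \<Rightarrow> real ^ 'n \<Rightarrow> (real \<Rightarrow> real ^ 'n) \<Rightarrow> bool" where
  "forward_solution F M x u \<longleftrightarrow>
     u 0 = x \<and> (\<forall>t\<ge>0. u t \<in> M \<and> (u has_vector_derivative F (u t)) (at t within {0..}))"

definition flow_of ::
    "(real ^ 'n \<Rightarrow> real ^ 'n) \<Rightarrow> (real ^ 'n) set \<Rightarrow> (real \<Rightarrow> real ^ 'n \<Rightarrow> real ^ 'n) \<Rightarrow> bool" where
  "flow_of F M S \<longleftrightarrow>
     (\<forall>x\<in>M. forward_solution F M x (\<lambda>t. S t x) \<and>
            (\<forall>u. forward_solution F M x u \<longrightarrow> (\<forall>t\<ge>0. u t = S t x)))"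

definition koopman :: "(real \<Rightarrow> 'x \<Rightarrow> 'x) \<Rightarrow> real \<Rightarrow> ('x \<Rightarrow> 'b) \<Rightarrow> 'x \<Rightarrow> 'b" where
  "koopman S t f = f \<circ> S t"

text \<open>As in the source, an eigenfunction is not required to be nonzero: on the basin of a repelling
  equilibrium, which is a single point, all the functions considered vanish.\<close>

definition koopman_eigenfunction ::
    "(real \<Rightarrow> 'x \<Rightarrow> 'x) \<Rightarrow> 'x set \<Rightarrow> complex \<Rightarrow> ('x \<Rightarrow> complex) \<Rightarrow> bool" where
  "koopman_eigenfunction S E \<mu> \<phi> \<longleftrightarrow>
     (\<forall>x\<in>E. \<forall>t\<ge>0. S t x \<in> E) \<and>
     (\<forall>x\<in>E. \<forall>t\<ge>0. koopman S t \<phi> x = exp (\<mu> * of_real t) * \<phi> x)"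

definition subdomain_eigenfunction ::
    "(real \<Rightarrow> 'x \<Rightarrow> 'x) \<Rightarrow> 'x set \<Rightarrow> 'x set \<Rightarrow> complex \<Rightarrow> ('x \<Rightarrow> complex) \<Rightarrow> bool" where
  "subdomain_eigenfunction S M E \<mu> \<phi> \<longleftrightarrow> E \<subset> M \<and> koopman_eigenfunction S E \<mu> \<phi>"

definition basin ::
    "(real \<Rightarrow> real ^ 'n \<Rightarrow> real ^ 'n) \<Rightarrow> (real ^ 'n) set \<Rightarrow> (real ^ 'n) set \<Rightarrow> (real ^ 'n) set" where
  "basin S M D = {x \<in> M. (\<forall>t\<ge>0. S t x \<in> D) \<and> ((\<lambda>t. S t x) \<longlongrightarrow> 0) at_top}"

definition cvec :: "real ^ 'n \<Rightarrow> complex ^ 'n" where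
  "cvec x = (\<chi> i. complex_of_real (x $ i))"

definition cmat :: "real ^ 'n ^ 'm \<Rightarrow> complex ^ 'n ^ 'm" where
  "cmat A = (\<chi> i j. complex_of_real (A $ i $ j))"

definition cinner :: "complex ^ 'n \<Rightarrow> complex ^ 'n \<Rightarrow> complex" where
  "cinner x y = (\<Sum>i\<in>UNIV. x $ i * cnj (y $ i))"

definition cadjoint :: "complex ^ 'n ^ 'm \<Rightarrow> complex ^ 'm ^ 'n" where
  "cadjoint A = (\<chi> i j. cnj (A $ j $ i))"

text \<open>\<open>diagonalized_by A lam v\<close>: the family \<open>v\<close> is a basis of \<open>\<complex>\<^sup>n\<close> consisting of
  eigenvectors; eigenvalues are listed with multiplicity.\<close>

definition diagonalized_by :: "complex ^ 'n ^ 'n \<Rightarrow> ('n \<Rightarrow> complex) \<Rightarrow> ('n \<Rightarrow> complex ^ 'n) \<Rightarrow> bool" where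
  "diagonalized_by A lam v \<longleftrightarrow>
     (\<forall>j. A *v v j = lam j *s v j) \<and>
     inj v \<and> vec.independent (range v) \<and> vec.span (range v) = UNIV"

definition dual_eigenvectors ::
    "complex ^ 'n ^ 'n \<Rightarrow> ('n \<Rightarrow> complex) \<Rightarrow> ('n \<Rightarrow> complex ^ 'n) \<Rightarrow> ('n \<Rightarrow> complex ^ 'n) \<Rightarrow> bool" where
  "dual_eigenvectors A lam v w \<longleftrightarrow>
     (\<forall>j. cadjoint A *v w j = cnj (lam j) *s w j) \<and>
     (\<forall>i j. cinner (v i) (w j) = (if i = j then 1 else 0))"

definition nonresonant :: "('n::finite \<Rightarrow> complex) \<Rightarrow> bool" where
  "nonresonant lam \<longleftrightarrow>
     \<not> (\<exists>(m::'n \<Rightarrow> nat) r. (\<Sum>k\<in>UNIV. m k) \<ge> 2 \<and> lam r = (\<Sum>k\<in>UNIV. of_nat (m k) * lam k))"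

definition siegel_condition :: "('n::finite \<Rightarrow> complex) \<Rightarrow> bool" where
  "siegel_condition lam \<longleftrightarrow>
     (\<exists>C \<nu>. C > 0 \<and> \<nu> > 1 \<and>
        (\<forall>(m::'n \<Rightarrow> nat) r. (\<Sum>k\<in>UNIV. m k) \<ge> 2 \<longrightarrow>
           norm (lam r - (\<Sum>k\<in>UNIV. of_nat (m k) * lam k))
             \<ge> C / real (\<Sum>k\<in>UNIV. m k) powr \<nu>))"

text \<open>\<open>y = h x\<close> turns \<open>x' = F x\<close> into \<open>y' = A y\<close>: \<open>Dh(x) F(x) = A h(x)\<close> on \<open>N\<close>.\<close>

definition conjugates_to_linear ::
    "(real ^ 'n \<Rightarrow> real ^ 'n) \<Rightarrow> real ^ 'n ^ 'n \<Rightarrow> (real ^ 'n \<Rightarrow> real ^ 'n) \<Rightarrow> (real ^ 'n) set \<Rightarrow> bool" where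
  "conjugates_to_linear F A h N \<longleftrightarrow>
     (\<forall>x\<in>N. \<exists>h'. (h has_derivative h') (at x) \<and> h' (F x) = A *v h x)"

definition linearization ::
    "(real ^ 'n \<Rightarrow> real ^ 'n) \<Rightarrow> real ^ 'n ^ 'n \<Rightarrow> (real ^ 'n \<Rightarrow> real ^ 'n) \<Rightarrow> (real ^ 'n) set \<Rightarrow> bool" where
  "linearization F A h N \<longleftrightarrow>
     0 \<in> N \<and> analytic_diffeo_on h N \<and> h 0 = 0 \<and> conjugates_to_linear F A h N"

definition local_eigenfunctions ::
    "(real ^ 'n \<Rightarrow> real ^ 'n) \<Rightarrow> ('n \<Rightarrow> complex ^ 'n) \<Rightarrow> real ^ 'n \<Rightarrow> complex ^ 'n" where
  "local_eigenfunctions h w x = (\<chi> j. cinner (cvec (h x)) (w j))"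

text \<open>The value is the common value of \<open>exp (- lam j * t) * s (S t z) $ j\<close> over all \<open>t\<close> after which the
  trajectory of \<open>z\<close> remains in \<open>N\<close>. It is meaningful only where such \<open>t\<close> exist, e.g. on the basin.\<close>

definition flow_extension ::
    "(real \<Rightarrow> real ^ 'n \<Rightarrow> real ^ 'n) \<Rightarrow> (real ^ 'n) set \<Rightarrow> ('n \<Rightarrow> complex) \<Rightarrow>
     (real ^ 'n \<Rightarrow> complex ^ 'n) \<Rightarrow> real ^ 'n \<Rightarrow> complex ^ 'n" where
  "flow_extension S N lam s z =
     (\<chi> j. THE c. \<forall>t\<ge>0. (\<forall>\<tau>\<ge>t. S \<tau> z \<in> N) \<longrightarrow>
                        c = exp (- lam j * of_real t) * s (S t z) $ j)"

text \<open>\<open>g\<close> is a function on a subset \<open>Y\<close> of \<open>\<complex>\<^sup>n\<close>. For \<open>Y = s ` N\<close>, a neighbourhood of \<open>0\<close> in a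
  totally real subspace of real dimension \<open>n\<close>, the coefficients are determined by \<open>g\<close>.\<close>

definition taylor_expansion_at_0 ::
    "(complex ^ 'n \<Rightarrow> complex ^ 'm) \<Rightarrow> (complex ^ 'n) set \<Rightarrow> (nat ^ 'n \<Rightarrow> complex ^ 'm) \<Rightarrow> bool" where
  "taylor_expansion_at_0 g Y c \<longleftrightarrow>
     (\<exists>r>0. \<forall>y \<in> Y \<inter> ball 0 r. ((\<lambda>k. monomial y k *s c k) has_sum g y) UNIV)"

end

theory Submission
  imports Defs
begin

text \<open>Along a trajectory inside \<open>N\<close>, the conjugacy gives \<open>s\<^sub>j' = \<lambda>\<^sub>j s\<^sub>j\<close>, so
  \<open>exp (- \<lambda>\<^sub>j t) s\<^sub>j (S\<^sup>t z)\<close> is constant as soon as the trajectory has settled in \<open>N\<close>. Hence the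
  extension is well defined on the basin and, by the semigroup law, multiplied by \<open>exp (\<lambda>\<^sub>j t)\<close>
  under the flow. The expansion of \<open>U\<^sup>t f\<close> at \<open>x\<close> is the assumed expansion of \<open>f\<close> at the point
  \<open>S\<^sup>t x\<close> of the basin.\<close>

lemma flow_of_in: "S t x \<in> M" if "flow_of F M S" "x \<in> M" "t \<ge> 0"
  using that by (auto simp: flow_of_def forward_solution_def)

lemma flow_of_deriv:
  "((\<lambda>t. S t x) has_vector_derivative F (S t x)) (at t within {0..})"
  if "flow_of F M S" "x \<in> M" "t \<ge> 0"
  using that by (auto simp: flow_of_def forward_solution_def)

text \<open>The time-shifted trajectory solves the same autonomous equation from
  \<open>S t x\<close>, so uniqueness identifies it with the flow started there.\<close>

lemma flow_of_add:
  assumes flow: "flow_of F M S" and x: "x \<in> M" and t: "t \<ge> 0" and \<tau>: "\<tau> \<ge> 0"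
  shows "S \<tau> (S t x) = S (t + \<tau>) x"
proof -
  have "forward_solution F M (S t x) (\<lambda>r. S (t + r) x)"
    unfolding forward_solution_def
  proof (intro conjI allI impI)
    fix r :: real assume r: "r \<ge> 0"
    show "S (t + r) x \<in> M"
      using flow_of_in[OF flow x] t r by simp
    have "((\<lambda>q. S q x) has_vector_derivative F (S (t + r) x)) (at (t + r) within {0..})"
      using flow_of_deriv[OF flow x] t r by simp
    \<comment> \<open>The chain rule asks for the outer derivative within the image of
      \<open>{0..}\<close> under the shift, a subset of \<open>{0..}\<close> because
      \<open>t\<close> is nonnegative.\<close>
    then have "((\<lambda>q. S q x) has_vector_derivative F (S (t + r) x)) (at (t + r) within (+) t ` {0..})"
      by (rule has_vector_derivative_within_subset) (use t in auto)
    moreover have "((+) t has_vector_derivative 1) (at r within {0..})"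
      by (auto intro!: derivative_eq_intros)
    ultimately show "((\<lambda>r. S (t + r) x) has_vector_derivative F (S (t + r) x)) (at r within {0..})"
      using vector_diff_chain_within[of "(+) t" 1 r "{0..}" "\<lambda>q. S q x" "F (S (t + r) x)"]
      by (simp add: o_def)
  qed simp
  with flow flow_of_in[OF flow x t] \<tau> show ?thesis
    unfolding flow_of_def by metis
qed

text \<open>By the semigroup law the orbit of \<open>S t x\<close> is a tail of the orbit of
  \<open>x\<close>, so it inherits confinement to \<open>D\<close> and the limit.\<close>

lemma basin_flow_in:
  assumes flow: "flow_of F M S" and x: "x \<in> basin S M D" and t: "t \<ge> 0"
  shows "S t x \<in> basin S M D"
proof -
  have xM: "x \<in> M" and D: "\<And>t. t \<ge> 0 \<Longrightarrow> S t x \<in> D" and lim: "((\<lambda>t. S t x) \<longlongrightarrow> 0) at_top"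
    using x by (auto simp: basin_def)
  have "((\<lambda>\<tau>. S (t + \<tau>) x) \<longlongrightarrow> 0) at_top"
    by (rule filterlim_compose[OF lim]) (rule filterlim_tendsto_add_at_top[OF tendsto_const filterlim_ident])
  \<comment> \<open>The semigroup law holds only for nonnegative times, so the two functions are
    compared eventually.\<close>
  moreover have "eventually (\<lambda>\<tau>. S (t + \<tau>) x = S \<tau> (S t x)) at_top"
    using eventually_ge_at_top[of 0] by eventually_elim (simp add: flow_of_add[OF flow xM t])
  ultimately have "((\<lambda>\<tau>. S \<tau> (S t x)) \<longlongrightarrow> 0) at_top"
    by (rule Lim_transform_eventually)
  then show ?thesis
    using flow_of_in[OF flow xM t] D t by (auto simp: basin_def flow_of_add[OF flow xM t])
qed

lemma basin_eventually_in:
  assumes "x \<in> basin S M D" and "open N" and "0 \<in> N"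
  obtains T where "T \<ge> 0" and "\<forall>\<tau>\<ge>T. S \<tau> x \<in> N"
proof -
  have "eventually (\<lambda>t. S t x \<in> N) at_top"
    using assms by (auto simp: basin_def intro: topological_tendstoD)
  then obtain T where "\<forall>t\<ge>T. S t x \<in> N"
    by (auto simp: eventually_at_top_linorder)
  \<comment> \<open>The limit filter ranges over all reals and may yield a negative
    \<open>T\<close>, where the flow is unconstrained; hence the maximum with
    \<open>0\<close>.\<close>
  then show ?thesis
    using that[of "max 0 T"] by simp
qed

lemma cvec_matrix_vector_mult: "cvec (A *v x) = cmat A *v cvec x"
  by (simp add: cvec_def cmat_def matrix_vector_mult_def vec_eq_iff)

lemma cinner_cadjoint: "cinner (A *v x) y = cinner x (cadjoint A *v y)"
proof -
  have "cinner (A *v x) y = (\<Sum>i\<in>UNIV. \<Sum>j\<in>UNIV. A $ i $ j * x $ j * cnj (y $ i))"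
    by (simp add: cinner_def matrix_vector_mult_def sum_distrib_right)
  also have "\<dots> = (\<Sum>j\<in>UNIV. \<Sum>i\<in>UNIV. A $ i $ j * x $ j * cnj (y $ i))"
    by (rule sum.swap)
  also have "\<dots> = cinner x (cadjoint A *v y)"
    by (simp add: cinner_def cadjoint_def matrix_vector_mult_def sum_distrib_left algebra_simps)
  finally show ?thesis .
qed

lemma cinner_scale_right: "cinner x (c *s y) = cnj c * cinner x y"
  by (simp add: cinner_def sum_distrib_left algebra_simps)

lemma bounded_linear_cinner_cvec: "bounded_linear (\<lambda>x. cinner (cvec x) y)"
  unfolding cinner_def cvec_def
  by (auto intro!: bounded_linear_sum bounded_linear_mult_const
      bounded_linear_compose[OF bounded_linear_of_real bounded_linear_vec_nth])

text \<open>Differentiating \<open>h\<close> along \<open>u\<close> gives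
  \<open>A *v h (u t)\<close>. Pairing with \<open>w j\<close> moves \<open>A\<close> to its
  adjoint, which acts on \<open>w j\<close> as the scalar \<open>cnj \<mu>\<close>.\<close>

lemma local_eigenfunctions_deriv:
  assumes conj: "conjugates_to_linear F A h N"
    and w: "cadjoint (cmat A) *v w j = cnj \<mu> *s w j"
    and u: "(u has_vector_derivative F (u t)) (at t within I)" and N: "u t \<in> N"
  shows "((\<lambda>t. local_eigenfunctions h w (u t) $ j) has_vector_derivative
           \<mu> * local_eigenfunctions h w (u t) $ j) (at t within I)"
proof -
  obtain h' where h': "(h has_derivative h') (at (u t))" "h' (F (u t)) = A *v h (u t)"
    using conj N by (auto simp: conjugates_to_linear_def)
  have "((h \<circ> u) has_vector_derivative h' (F (u t))) (at t within I)"
    using vector_derivative_diff_chain_within[OF u has_derivative_at_withinI[OF h'(1)]] .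
  then have "((\<lambda>t. cinner (cvec ((h \<circ> u) t)) (w j)) has_vector_derivative
               cinner (cvec (A *v h (u t))) (w j)) (at t within I)"
    unfolding h'(2) by (rule bounded_linear.has_vector_derivative[OF bounded_linear_cinner_cvec])
  \<comment> \<open>\<open>cinner\<close> is conjugate-linear in its second argument, so
    \<open>cnj \<mu>\<close> comes out as \<open>\<mu>\<close>.\<close>
  moreover have "cinner (cvec (A *v h (u t))) (w j) = \<mu> * cinner (cvec (h (u t))) (w j)"
    by (simp add: cvec_matrix_vector_mult cinner_cadjoint w cinner_scale_right)
  ultimately show ?thesis
    by (simp add: local_eigenfunctions_def)
qed

text \<open>The product rule gives the rescaled function derivative zero on a convex half-line. The
  derivative at \<open>T\<close> is one-sided, which admits \<open>T = 0\<close>, the start of a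
  trajectory.\<close>

lemma linear_ode_rescaled_constant:
  fixes u :: "real \<Rightarrow> complex"
  assumes u: "\<And>t. t \<ge> T \<Longrightarrow> (u has_vector_derivative \<mu> * u t) (at t within {T..})"
    and "a \<ge> T" and "b \<ge> T"
  shows "exp (- \<mu> * of_real a) * u a = exp (- \<mu> * of_real b) * u b"
proof -
  have "((\<lambda>t. exp (- \<mu> * of_real t) * u t) has_vector_derivative 0) (at t within {T..})"
    if "t \<in> {T..}" for t
  proof -
    have "((\<lambda>t. exp (of_real t * - \<mu>)) has_vector_derivative exp (of_real t * - \<mu>) * - \<mu>) (at t within {T..})"
      using exp_scaleR_has_vector_derivative_right[of "- \<mu>" t "{T..}"] by (simp add: scaleR_conv_of_real)
    from has_vector_derivative_mult[OF this u[of t]] that show ?thesis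
      by (simp add: algebra_simps)
  qed
  then obtain c where "\<And>t. t \<in> {T..} \<Longrightarrow> exp (- \<mu> * of_real t) * u t = c"
    using has_vector_derivative_zero_constant[of "{T..}" "\<lambda>t. exp (- \<mu> * of_real t) * u t"]
    by auto
  with assms show ?thesis by auto
qed

text \<open>This makes the definite description in \<open>flow_extension\<close> meaningful: any two
  admissible times give the same value, so one may evaluate at whichever is convenient.\<close>

lemma flow_extension_eq:
  assumes flow: "flow_of F M S" and x: "x \<in> M"
    and conj: "conjugates_to_linear F A h N"
    and w: "\<And>j. cadjoint (cmat A) *v w j = cnj (lam j) *s w j"
    and T: "T \<ge> 0" "\<forall>\<tau>\<ge>T. S \<tau> x \<in> N"
  shows "flow_extension S N lam (local_eigenfunctions h w) x $ j =
         exp (- lam j * of_real T) * local_eigenfunctions h w (S T x) $ j"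
proof -
  let ?s = "\<lambda>t. local_eigenfunctions h w (S t x) $ j"
  have const: "exp (- lam j * of_real a) * ?s a = exp (- lam j * of_real b) * ?s b"
    if ab: "a \<ge> 0" "b \<ge> 0" "\<forall>\<tau>\<ge>a. S \<tau> x \<in> N" "\<forall>\<tau>\<ge>b. S \<tau> x \<in> N" for a b
  \<comment> \<open>The half-line from \<open>min a b\<close> contains both times, and the
    trajectory stays in \<open>N\<close> along it, since the smaller time is itself
    admissible.\<close>
  proof (rule linear_ode_rescaled_constant[where T = "min a b"])
    fix t assume t: "t \<ge> min a b"
    then have "((\<lambda>t. S t x) has_vector_derivative F (S t x)) (at t within {min a b..})"
      using ab by (intro has_vector_derivative_within_subset[OF flow_of_deriv[OF flow x]]) auto
    moreover have "S t x \<in> N"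
      using t ab by (auto simp: min_le_iff_disj)
    ultimately show "(?s has_vector_derivative lam j * ?s t) (at t within {min a b..})"
      by (rule local_eigenfunctions_deriv[where u = "\<lambda>t. S t x", OF conj w])
  qed auto
  show ?thesis
    unfolding flow_extension_def vec_lambda_beta
    \<comment> \<open>Existence is \<open>const\<close> between \<open>T\<close> and an arbitrary
      admissible time; uniqueness is the defining property read at \<open>T\<close>.\<close>
    by (rule the_equality) (use T const in blast)+
qed

lemma flow_extension_flow:
  assumes flow: "flow_of F M S" and x: "x \<in> basin S M D"
    and N: "open N" "0 \<in> N" and conj: "conjugates_to_linear F A h N"
    and w: "\<And>j. cadjoint (cmat A) *v w j = cnj (lam j) *s w j"
    and t: "t \<ge> 0"
  defines "s \<equiv> flow_extension S N lam (local_eigenfunctions h w)"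
  shows "s (S t x) $ j = exp (lam j * of_real t) * s x $ j"
proof -
  have xM: "x \<in> M"
    using x by (simp add: basin_def)
  obtain T where T: "T \<ge> 0" "\<forall>\<tau>\<ge>T. S \<tau> x \<in> N"
    using basin_eventually_in[OF x N] .
  \<comment> \<open>Time \<open>T\<close> for \<open>S t x\<close> and time \<open>t + T\<close> for
    \<open>x\<close> evaluate the local eigenfunction at the same point, so the two values differ
    only in the exponential prefactor.\<close>
  have "s (S t x) $ j = exp (- lam j * of_real T) * local_eigenfunctions h w (S T (S t x)) $ j"
    unfolding s_def
    by (rule flow_extension_eq[OF flow flow_of_in[OF flow xM t] conj w])
      (use T t in \<open>auto simp: flow_of_add[OF flow xM t]\<close>)
  moreover have "s x $ j =
      exp (- lam j * of_real (t + T)) * local_eigenfunctions h w (S (t + T) x) $ j"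
    unfolding s_def by (rule flow_extension_eq[OF flow xM conj w]) (use T t in auto)
  moreover have "exp (- lam j * of_real T) = exp (lam j * of_real t) * exp (- lam j * of_real (t + T))"
    by (simp add: algebra_simps flip: exp_add)
  ultimately show ?thesis
    using T t by (simp add: flow_of_add[OF flow xM t])
qed

lemma monomial_exp_scale:
  assumes "\<And>j. z $ j = exp (lam j * of_real t) * y $ j"
  shows "monomial z k = monomial y k * exp ((\<Sum>j\<in>UNIV. of_nat (k $ j) * lam j) * of_real t :: complex)"
proof -
  have "monomial z k = monomial y k * (\<Prod>j\<in>UNIV. exp (lam j * of_real t) ^ (k $ j))"
    by (simp add: monomial_def assms power_mult_distrib prod.distrib mult.commute)
  also have "(\<Prod>j\<in>UNIV. exp (lam j * of_real t) ^ (k $ j)) =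
      exp (\<Sum>j\<in>UNIV. of_nat (k $ j) * (lam j * of_real t))"
    by (simp add: exp_sum exp_of_nat_mult)
  also have "(\<Sum>j\<in>UNIV. of_nat (k $ j) * (lam j * of_real t)) =
      (\<Sum>j\<in>UNIV. of_nat (k $ j) * lam j) * of_real t"
    by (simp add: sum_distrib_right mult.assoc)
  finally show ?thesis .
qed

text \<open>The map \<open>h\<close> and its domain \<open>N\<close> enter as given data, so the
  conclusion covers every linearization of this kind. The sum is unconditional, hence independent of
  any ordering of the multi-indices.\<close>

theorem proposition5p3:
  fixes F :: "real ^ 'n \<Rightarrow> real ^ 'n"
    and M D N :: "(real ^ 'n) set"
    and S :: "real \<Rightarrow> real ^ 'n \<Rightarrow> real ^ 'n"
    and A :: "real ^ 'n ^ 'n"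
    and lam :: "'n \<Rightarrow> complex"
    and v w :: "'n \<Rightarrow> complex ^ 'n"
    and h :: "real ^ 'n \<Rightarrow> real ^ 'n"
    and s s_ext :: "real ^ 'n \<Rightarrow> complex ^ 'n"
    and f :: "real ^ 'n \<Rightarrow> complex ^ 'm"
    and vbar :: "nat ^ 'n \<Rightarrow> complex ^ 'm"
    and B :: "(real ^ 'n) set"
  assumes "open D" and "0 \<in> D" and "D \<subseteq> M"
    and "\<exists>U. open U \<and> 0 \<in> U \<and> U \<subseteq> D \<and> real_analytic_on F U"
    and "F 0 = 0"
    and "(F has_derivative (\<lambda>x. A *v x)) (at 0)"
    and "diagonalized_by (cmat A) lam v"
    and "nonresonant lam"
    and "(\<forall>j. Re (lam j) < 0) \<or> (\<forall>j. Re (lam j) > 0) \<or> siegel_condition lam"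
    and "flow_of F M S"
    and "B = basin S M D"
    and "N \<subseteq> D" and "linearization F A h N"
    and "dual_eigenvectors (cmat A) lam v w"
    and "s = local_eigenfunctions h w"
    and "s_ext = flow_extension S N lam s"
    and "real_analytic_on f D"
    and "taylor_expansion_at_0 (f \<circ> inv_into N s) (s ` N) vbar"
    and "\<forall>x\<in>B. ((\<lambda>k. monomial (s_ext x) k *s vbar k) has_sum f x) UNIV"
  shows "(\<forall>x\<in>B. \<forall>t\<ge>0.
            ((\<lambda>k. (monomial (s_ext x) k * exp ((\<Sum>j\<in>UNIV. of_nat (k $ j) * lam j) * of_real t)) *s vbar k)
               has_sum koopman S t f x) UNIV)
       \<and> (\<forall>j. koopman_eigenfunction S B (lam j) (\<lambda>x. s_ext x $ j))
       \<and> (B \<noteq> M \<longrightarrow> (\<forall>j. subdomain_eigenfunction S M B (lam j) (\<lambda>x. s_ext x $ j)))"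
proof (intro conjI allI impI ballI)
  have N: "open N" "0 \<in> N" and conj: "conjugates_to_linear F A h N"
    using \<open>linearization F A h N\<close> by (auto simp: linearization_def analytic_diffeo_on_def)
  have w: "cadjoint (cmat A) *v w j = cnj (lam j) *s w j" for j
    using \<open>dual_eigenvectors (cmat A) lam v w\<close> by (simp add: dual_eigenvectors_def)
  have inv: "S t x \<in> B" if "x \<in> B" "t \<ge> 0" for x t
    using basin_flow_in[OF \<open>flow_of F M S\<close>] that \<open>B = basin S M D\<close> by simp
  have ext: "s_ext (S t x) $ j = exp (lam j * of_real t) * s_ext x $ j"
    if "x \<in> B" "t \<ge> 0" for x t j
    using flow_extension_flow[OF \<open>flow_of F M S\<close> _ N conj w] that
      \<open>B = basin S M D\<close> \<open>s = local_eigenfunctions h w\<close> \<open>s_ext = flow_extension S N lam s\<close>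
    by simp
  show "((\<lambda>k. (monomial (s_ext x) k * exp ((\<Sum>j\<in>UNIV. of_nat (k $ j) * lam j) * of_real t)) *s vbar k)
          has_sum koopman S t f x) UNIV" if "x \<in> B" "t \<ge> 0" for x t
  proof -
    have "((\<lambda>k. monomial (s_ext (S t x)) k *s vbar k) has_sum f (S t x)) UNIV"
      using assms(19) inv[OF that] by blast
    \<comment> \<open>The two series agree term by term, so no rearrangement or limit exchange is
      involved.\<close>
    then show ?thesis
      by (simp add: monomial_exp_scale[of _ lam, OF ext[OF that]] koopman_def)
  qed
  show eig: "koopman_eigenfunction S B (lam j) (\<lambda>x. s_ext x $ j)" for j
    using inv ext by (simp add: koopman_eigenfunction_def koopman_def)
  show "subdomain_eigenfunction S M B (lam j) (\<lambda>x. s_ext x $ j)" if "B \<noteq> M" for j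
    using that eig \<open>B = basin S M D\<close> by (auto simp: subdomain_eigenfunction_def basin_def)
qed

end
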